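(* Let $A\in\mathbb{R}^{n\times n_s}$ with $n\ge n_s$, let $1\le r\le \operatorname{rank}(A)$, and let $W\in\mathbb{R}^{n\times r}$ have as its (orthonormal) columns left singular vectors of $A$ corresponding to its $r$ largest singular values. Let $\widehat W\in\mathbb{R}^{n\times r}$ be any matrix with orthonormal columns, and let $S,\widehat S\in\mathbb{R}^{n\times s}$ be selection operators with $s=r$. Put $\mathbb{D}=W(S^\top W)^\dagger S^\top$ and $\widehat{\mathbb{D}}=\widehat W(\widehat S^\top\widehat W)^\dagger\widehat S^\top$, and assume $\operatorname{rank}(\mathbb{D})=\operatorname{rank}(S^\top W)=r$, $\operatorname{rank}(\widehat{\mathbb{D}})=\operatorname{rank}(\widehat S^\top\widehat W)=r$, and that neither $\mathbb{D}$ nor $\widehat{\mathbb{D}}$ equals $0$ or $I_n$. Let $P_W=WW^\top$ and $P_S=SS^\dagger$, let $\theta_{\max}$ be the largest canonical angle between the column spaces of $W$ and $\widehat W$, and let $\psi_{\max}$ be the largest canonical angle between the column spaces of $S$ and $\widehat S$. Then for every $f\in\mathbb{R}^n$, $$\|f-\widehat{\mathbb{D}}f\|_2\le \|\mathbb{D}\|_2\|(I_n-P_W)f\|_2+\|\mathbb{D}\|_2\|\widehat{\mathbb{D}}\|_2\left(\sin\psi_{\max}\|(I_n-P_W)f\|_2+\sin\theta_{\max}\|P_Sf\|_2\right).$$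
   Context: A selection operator is a matrix each of whose columns is a nonzero scalar multiple of a column of the $n\times n$ identity matrix $I_n$. $\|\cdot\|_2$ is the Euclidean norm of vectors and the spectral norm of matrices; $M^\dagger$ is the Moore-Penrose pseudoinverse. For two $r$-dimensional subspaces of $\mathbb{R}^n$ with orthonormal bases given by the columns of $U,V\in\mathbb{R}^{n\times r}$, the canonical angles are $\arccos\sigma_i(U^\top V)\in[0,\pi/2]$, $i=1,\dots,r$, where $\sigma_i(U^\top V)$ are the singular values of $U^\top V$; the sine of the largest canonical angle equals $\|UU^\top-VV^\top\|_2$. *)

theory Defs
  imports "HOL-Analysis.Analysis"
begin

text \<open>Matrices with \<open>m\<close> rows and \<open>n\<close> columns have type \<open>real^'n^'m\<close>. The type-class norm
  on this type is the Frobenius norm, so the spectral norm is the operator norm of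
  the induced map.\<close>

definition spectral_norm :: "real^'n^'m \<Rightarrow> real" where
  "spectral_norm M = onorm (\<lambda>x. M *v x)"

definition orthonormal_columns :: "real^'r^'n \<Rightarrow> bool" where
  "orthonormal_columns U \<longleftrightarrow> transpose U ** U = mat 1"

definition column_space :: "real^'r^'n \<Rightarrow> (real^'n) set" where
  "column_space M = span (columns M)"

text \<open>Repeated columns are allowed.\<close>

definition selection_operator :: "real^'s^'n \<Rightarrow> bool" where
  "selection_operator S \<longleftrightarrow> (\<forall>j. \<exists>c i. c \<noteq> 0 \<and> column j S = c *\<^sub>R column i (mat 1))"

text \<open>The four Penrose conditions determine the pseudoinverse uniquely.\<close>

definition pinv :: "real^'n^'m \<Rightarrow> real^'m^'n" where
  "pinv M = (THE X. M ** X ** M = M \<and> X ** M ** X = X \<and>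
      transpose (M ** X) = M ** X \<and> transpose (X ** M) = X ** M)"

text \<open>Because both \<open>u\<close> and \<open>v\<close> must be unit vectors, \<open>\<sigma> = 0\<close> occurs only if both \<open>M\<close> and its
  transpose have a nontrivial kernel. Hence the values \<open>\<sigma>\<close> that occur are exactly the
  \<open>min m n\<close> singular values of an \<open>m \<times> n\<close> matrix.\<close>

definition singular_triple :: "real^'n^'m \<Rightarrow> real \<Rightarrow> real^'m \<Rightarrow> real^'n \<Rightarrow> bool" where
  "singular_triple M \<sigma> u v \<longleftrightarrow> \<sigma> \<ge> 0 \<and> norm u = 1 \<and> norm v = 1 \<and>
      M *v v = \<sigma> *\<^sub>R u \<and> transpose M *v u = \<sigma> *\<^sub>R v"

definition singular_values :: "real^'n^'m \<Rightarrow> real set" where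
  "singular_values M = {\<sigma>. \<exists>u v. singular_triple M \<sigma> u v}"

text \<open>For a matrix with at least as many rows as columns: since \<open>V\<close> is orthogonal, the
  conditions amount to \<open>A = U \<Sigma> V\<^sup>T\<close> with \<open>\<Sigma>\<close> the diagonal matrix of the \<open>\<sigma> i\<close>, so \<open>\<sigma>\<close> lists
  the singular values with multiplicity (in no particular order).\<close>

definition thin_svd :: "real^'m^'n \<Rightarrow> real^'m^'n \<Rightarrow> ('m \<Rightarrow> real) \<Rightarrow> real^'m^'m \<Rightarrow> bool" where
  "thin_svd A U \<sigma> V \<longleftrightarrow> orthonormal_columns U \<and> orthogonal_matrix V \<and>
      (\<forall>i. singular_triple A (\<sigma> i) (column i U) (column i V))"

text \<open>\<open>p\<close> selects the positions of the \<open>r\<close> largest singular values, counted with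
  multiplicity; ties may be broken arbitrarily.\<close>

definition leading_left_singular_vectors :: "real^'m^'n \<Rightarrow> real^'r^'n \<Rightarrow> bool" where
  "leading_left_singular_vectors A W \<longleftrightarrow>
     (\<exists>U \<sigma> V (p :: 'r \<Rightarrow> 'm). thin_svd A U \<sigma> V \<and> inj p \<and>
        (\<forall>j. \<forall>i. i \<notin> range p \<longrightarrow> \<sigma> i \<le> \<sigma> (p j)) \<and>
        (\<forall>j. column j W = column (p j) U))"

text \<open>Canonical angles between two subspaces whose common dimension is the cardinality of
  \<open>'r\<close>. The angles do not depend on the orthonormal bases \<open>U\<close> and \<open>V\<close>; the type argument
  only fixes the index type of the bases.\<close>

definition canonical_angles :: "'r::finite itself \<Rightarrow> (real^'n) set \<Rightarrow> (real^'n) set \<Rightarrow> real set" where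
  "canonical_angles _ X Y = {arccos \<sigma> | \<sigma> (U :: real^'r^'n) (V :: real^'r^'n).
      orthonormal_columns U \<and> orthonormal_columns V \<and>
      column_space U = X \<and> column_space V = Y \<and>
      \<sigma> \<in> singular_values (transpose U ** V)}"

definition max_canonical_angle :: "'r::finite itself \<Rightarrow> (real^'n) set \<Rightarrow> (real^'n) set \<Rightarrow> real" where
  "max_canonical_angle r X Y = Max (canonical_angles r X Y)"

end

(* D and D' are oblique projections with range D = range W, ker D = ker S^T (similarly for D'),
   so f - D' f = (f - D f) + (I - D')(I - P_W') P_W D f - D' P_S' (I - P_S)(f - D f).
   The middle factors are bounded by the sines of the largest canonical angles, and
   |I - D| <= |D| for every nonzero projection D. *)
theory Submission
  imports Defs
begin

text \<open>As a simp rule this turns \<open>transpose A *v x\<close> into \<open>x v* A\<close>;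
  the adjoint is kept in the first form, in which the inner product rules below are stated.\<close>

declare transpose_matrix_vector [simp del]

section \<open>Matrices with orthonormal columns\<close>

lemma inner_matrix_vector_mult_left:
  fixes A :: "real^'n^'m"
  shows "(A *v x) \<bullet> y = x \<bullet> (transpose A *v y)"
  by (metis dot_lmul_matrix inner_commute vector_transpose_matrix)

lemma inner_orthonormal_columns:
  fixes U :: "real^'r^'n"
  assumes "orthonormal_columns U"
  shows "(U *v x) \<bullet> (U *v y) = x \<bullet> y"
  using assms
  by (simp add: inner_matrix_vector_mult_left matrix_vector_mul_assoc orthonormal_columns_def)

lemma norm_orthonormal_columns:
  fixes U :: "real^'r^'n"
  assumes "orthonormal_columns U"
  shows "norm (U *v x) = norm x"
  using assms by (simp add: norm_eq_sqrt_inner inner_orthonormal_columns)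

lemma range_matrix_vector_mult:
  fixes U :: "real^'r^'n"
  shows "range ((*v) U) = column_space U"
proof
  show "range ((*v) U) \<subseteq> column_space U"
    by (auto simp: column_space_def matrix_vector_mult_in_columnspace)
  have "subspace (range ((*v) U))"
    by (simp add: linear_subspace_image)
  moreover have "columns U \<subseteq> range ((*v) U)"
    by (auto simp: columns_image_basis)
  ultimately show "column_space U \<subseteq> range ((*v) U)"
    unfolding column_space_def by (rule span_minimal[rotated])
qed

lemma projection_fixes_column_space:
  fixes U :: "real^'r^'n"
  assumes "orthonormal_columns U" and "x \<in> column_space U"
  shows "U *v (transpose U *v x) = x"
proof -
  obtain z where "x = U *v z"
    using assms(2) by (auto simp flip: range_matrix_vector_mult)
  then show ?thesis
    using assms(1) by (simp add: matrix_vector_mul_assoc orthonormal_columns_def)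
qed

lemma projection_mult:
  fixes U :: "real^'r^'n" and S :: "real^'s^'n"
  assumes "orthonormal_columns U" and "column_space S \<subseteq> column_space U"
  shows "U ** transpose U ** S = S"
proof -
  have "S *v x \<in> column_space U" for x
    using assms(2) by (auto simp flip: range_matrix_vector_mult)
  then show ?thesis
    using projection_fixes_column_space[OF assms(1)]
    by (simp add: matrix_eq flip: matrix_vector_mul_assoc)
qed

text \<open>Each projection fixes the column space of the other, so P Q = Q and Q P = P. Both are
  symmetric, so transposing P Q = Q gives Q P = Q, hence P = Q.\<close>

lemma projection_unique:
  fixes U :: "real^'r^'n" and V :: "real^'s^'n"
  assumes "orthonormal_columns U" and "orthonormal_columns V"
    and "column_space U = column_space V"
  shows "U ** transpose U = V ** transpose V"
proof -
  let ?P = "U ** transpose U" and ?Q = "V ** transpose V"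
  have "?P ** ?Q = ?Q" "?Q ** ?P = ?P"
    using projection_mult[OF assms(1), of V] projection_mult[OF assms(2), of U] assms(3)
    by (simp_all add: matrix_mul_assoc)
  moreover have "transpose (?P ** ?Q) = ?Q ** ?P"
    by (simp add: matrix_transpose_mul matrix_mul_assoc)
  moreover have "transpose ?Q = ?Q"
    by (simp add: matrix_transpose_mul)
  ultimately show ?thesis
    by metis
qed

text \<open>Canonical angles use bases indexed by a type, so an abstract orthonormal basis is laid
  out as the columns of a matrix over that index type.\<close>

lemma orthonormal_columns_exist:
  fixes X :: "(real^'n) set"
  assumes "subspace X" and "dim X = CARD('r)"
  obtains U :: "real^'r^'n" where "orthonormal_columns U" and "column_space U = X"
proof -
  obtain B where B: "pairwise orthogonal B" "\<And>x. x \<in> B \<Longrightarrow> norm x = 1"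
    "independent B" "card B = dim X" "span B = X"
    using orthonormal_basis_subspace[OF assms(1)] by metis
  have "finite B"
    using B(3) by (rule independent_imp_finite)
  then obtain b :: "'r \<Rightarrow> real^'n" where b: "bij_betw b UNIV B"
    using finite_same_card_bij[of "UNIV :: 'r set" B] B(4) assms(2) by auto
  define U :: "real^'r^'n" where "U = (\<chi> i j. b j $ i)"
  have col: "column j U = b j" for j
    by (simp add: column_def U_def vec_eq_iff)
  then have "columns U = B"
    using b by (auto simp: columns_def bij_betw_def)
  moreover have "orthonormal_columns U"
    unfolding orthonormal_columns_def vec_eq_iff
  proof (intro allI)
    fix i j
    have "(transpose U ** U) $ i $ j = b i \<bullet> b j"
      by (simp add: matrix_matrix_mult_def transpose_def U_def inner_vec_def)
    also have "\<dots> = (if i = j then 1 else 0)"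
    proof (cases "i = j")
      case True
      then show ?thesis
        using B(2)[of "b j"] b by (auto simp: bij_betw_def norm_eq_1)
    next
      case False
      then have "b i \<noteq> b j" "b i \<in> B" "b j \<in> B"
        using b by (auto simp: bij_betw_def inj_def)
      then show ?thesis
        using B(1) False by (auto simp: pairwise_def orthogonal_def)
    qed
    finally show "(transpose U ** U) $ i $ j = mat 1 $ i $ j"
      by (simp add: mat_def)
  qed
  ultimately show ?thesis
    using that B(5) by (auto simp: column_space_def)
qed

section \<open>The pseudoinverse of a matrix with independent columns\<close>

text \<open>\<open>pinv\<close> is a definite description, so uniqueness is the point. By symmetry
  \<open>M ** X\<close> and \<open>M ** Y\<close> absorb each other and agree, likewise
  \<open>X ** M\<close> and \<open>Y ** M\<close>; then Y = Y M Y = X M Y = X M X = X.\<close>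

lemma pinv_eqI:
  fixes M :: "real^'n^'m"
  assumes "M ** X ** M = M" "X ** M ** X = X"
    "transpose (M ** X) = M ** X" "transpose (X ** M) = X ** M"
  shows "pinv M = X"
  unfolding pinv_def
proof (rule the_equality)
  fix Y assume Y: "M ** Y ** M = M \<and> Y ** M ** Y = Y \<and>
      transpose (M ** Y) = M ** Y \<and> transpose (Y ** M) = Y ** M"
  have "M ** Y = transpose (M ** X ** (M ** Y))"
    using Y assms by (simp add: matrix_mul_assoc)
  also have "\<dots> = M ** Y ** (M ** X)"
    using Y assms by (simp only: matrix_transpose_mul[of "M ** X"])
  also have "\<dots> = M ** X"
    using Y by (simp add: matrix_mul_assoc)
  finally have 1: "M ** Y = M ** X" .
  have "Y ** M = transpose (Y ** M ** (X ** M))"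
    using Y assms by (metis matrix_mul_assoc)
  also have "\<dots> = X ** M ** (Y ** M)"
    using Y assms by (simp only: matrix_transpose_mul[of "Y ** M"])
  also have "\<dots> = X ** M"
    using Y by (metis matrix_mul_assoc)
  finally have 2: "Y ** M = X ** M" .
  show "Y = X"
    using Y assms 1 2 by (metis matrix_mul_assoc)
qed (use assms in auto)

text \<open>The index types differ but have equal size, so a left inverse comes from injectivity and
  a right inverse from surjectivity; the two then coincide.\<close>

lemma pinv_full_rank:
  fixes N :: "real^'r^'s"
  assumes "rank N = CARD('r)" and "CARD('s) = CARD('r)"
  shows "N ** pinv N = mat 1" and "pinv N ** N = mat 1"
proof -
  obtain X where X: "X ** N = mat 1"
    using assms(1) by (auto simp: full_rank_injective simp flip: matrix_left_invertible_injective)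
  obtain Y where Y: "N ** Y = mat 1"
    using assms full_rank_surjective[of N] matrix_right_invertible_surjective[of N] by auto
  have "X = Y"
    using X Y by (metis matrix_mul_assoc matrix_mul_lid matrix_mul_rid)
  then have "pinv N = X"
    using X Y by (intro pinv_eqI) auto
  then show "N ** pinv N = mat 1" "pinv N ** N = mat 1"
    using X Y \<open>X = Y\<close> by auto
qed

text \<open>Write S = U R with R = U^T S square. A left inverse L of S makes L U the inverse of R,
  and R^-1 U^T satisfies the Penrose conditions for S.\<close>

lemma mult_pinv_eq_projection:
  fixes U S :: "real^'s^'n"
  assumes "rank S = CARD('s)" and U: "orthonormal_columns U" "column_space U = column_space S"
  shows "S ** pinv S = U ** transpose U"
proof -
  obtain L where L: "L ** S = mat 1"
    using assms(1) by (auto simp: full_rank_injective simp flip: matrix_left_invertible_injective)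
  define R where "R = transpose U ** S"
  have S: "S = U ** R"
    using projection_mult[OF U(1), of S] U(2) by (simp add: R_def matrix_mul_assoc)
  then have 1: "L ** U ** R = mat 1"
    using L by (simp add: matrix_mul_assoc)
  then have 2: "R ** (L ** U) = mat 1"
    by (simp add: matrix_left_right_inverse)
  let ?X = "L ** U ** transpose U"
  have SX: "S ** ?X = U ** transpose U"
  proof -
    have "S ** ?X = U ** (R ** (L ** U)) ** transpose U"
      by (subst S) (simp only: matrix_mul_assoc)
    then show ?thesis
      by (simp add: 2)
  qed
  have XS: "?X ** S = mat 1"
    using 1 by (simp add: R_def matrix_mul_assoc)
  have "S ** ?X ** S = S" "?X ** S ** ?X = ?X"
    using XS by (metis matrix_mul_assoc matrix_mul_lid matrix_mul_rid)+
  then have "pinv S = ?X"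
    using SX XS by (intro pinv_eqI) (simp_all add: matrix_transpose_mul)
  then show ?thesis
    using SX by simp
qed

section \<open>The largest canonical angle\<close>

lemma singular_triple_transpose:
  "singular_triple (transpose M) \<sigma> u v \<longleftrightarrow> singular_triple M \<sigma> v u"
  by (auto simp: singular_triple_def)

lemma singular_values_transpose: "singular_values (transpose M) = singular_values M"
  by (auto simp: singular_values_def singular_triple_transpose)

text \<open>Swapping the subspaces transposes \<open>transpose U ** V\<close>, which exchanges left
  and right singular vectors and keeps the singular values.\<close>

lemma canonical_angles_commute:
  fixes X Y :: "(real^'n) set"
  shows "canonical_angles (r :: 'r::finite itself) X Y = canonical_angles r Y X"
proof -
  have "canonical_angles r X Y \<subseteq> canonical_angles r Y X" for X Y :: "(real^'n) set"
  proof
    fix t assume "t \<in> canonical_angles r X Y"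
    then obtain \<sigma> and U V :: "real^'r^'n" where
      "t = arccos \<sigma>" "orthonormal_columns U" "orthonormal_columns V" "column_space U = X"
      "column_space V = Y" "\<sigma> \<in> singular_values (transpose U ** V)"
      unfolding canonical_angles_def by auto
    moreover have "transpose V ** U = transpose (transpose U ** V)"
      by (simp add: matrix_transpose_mul)
    ultimately show "t \<in> canonical_angles r Y X"
      unfolding canonical_angles_def by (smt (verit) mem_Collect_eq singular_values_transpose)
  qed
  then show ?thesis
    by blast
qed

lemma max_canonical_angle_commute: "max_canonical_angle r X Y = max_canonical_angle r Y X"
  by (simp add: max_canonical_angle_def canonical_angles_commute)

section \<open>Finiteness of the set of canonical angles\<close>

text \<open>Eigenvectors for distinct eigenvalues are orthogonal; choosing one for each eigenvalue
  gives an independent, hence finite, set.\<close>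

lemma finite_eigenvalues_symmetric:
  fixes B :: "real^'n^'n"
  assumes "transpose B = B"
  shows "finite {c. \<exists>x. x \<noteq> 0 \<and> B *v x = c *\<^sub>R x}" (is "finite ?E")
proof -
  define e where "e c = (SOME x. x \<noteq> 0 \<and> B *v x = c *\<^sub>R x)" for c
  have e: "e c \<noteq> 0 \<and> B *v e c = c *\<^sub>R e c" if "c \<in> ?E" for c
    unfolding e_def by (rule someI_ex) (use that in blast)
  have orth: "e c \<bullet> e d = 0" if "c \<in> ?E" "d \<in> ?E" "c \<noteq> d" for c d
  proof -
    have "(B *v e c) \<bullet> e d = e c \<bullet> (B *v e d)"
      using assms by (simp add: inner_matrix_vector_mult_left)
    then show ?thesis
      using e[OF that(1)] e[OF that(2)] that(3) by simp
  qed
  have "inj_on e ?E"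
    using orth e by (metis (no_types, lifting) inj_onI inner_eq_zero_iff)
  moreover have "independent (e ` ?E)"
    using orth e by (intro pairwise_orthogonal_independent) (fastforce simp: pairwise_def orthogonal_def)+
  ultimately show ?thesis
    using independent_imp_finite finite_imageD by blast
qed

text \<open>Makes \<open>Max\<close> meaningful. The bases U, V vary, but the projections P, Q onto
  X, Y do not, and sigma^2 is an eigenvalue of the symmetric matrix Q P Q with eigenvector V
  v.\<close>

lemma finite_canonical_angles:
  fixes X Y :: "(real^'n) set"
  shows "finite (canonical_angles (r :: 'r::finite itself) X Y)"
proof (cases "canonical_angles r X Y = {}")
  case False
  then obtain U0 V0 :: "real^'r^'n" where UV0:
    "orthonormal_columns U0" "orthonormal_columns V0" "column_space U0 = X" "column_space V0 = Y"
    unfolding canonical_angles_def by auto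
  define P where "P = U0 ** transpose U0"
  define Q where "Q = V0 ** transpose V0"
  have symm: "transpose P = P" "transpose Q = Q"
    by (simp_all add: P_def Q_def matrix_transpose_mul)
  let ?E = "{c. \<exists>x. x \<noteq> 0 \<and> (Q ** P ** Q) *v x = c *\<^sub>R x}"
  have "canonical_angles r X Y \<subseteq> (\<lambda>c. arccos (sqrt c)) ` ?E"
  proof
    fix t assume "t \<in> canonical_angles r X Y"
    then obtain \<sigma> u v and U V :: "real^'r^'n" where
      t: "t = arccos \<sigma>" and UV: "orthonormal_columns U" "orthonormal_columns V"
      "column_space U = X" "column_space V = Y" and
      st: "singular_triple (transpose U ** V) \<sigma> u v"
      unfolding canonical_angles_def singular_values_def by auto
    have P: "P = U ** transpose U" and Q: "Q = V ** transpose V"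
      using UV0 UV projection_unique unfolding P_def Q_def by metis+
    have uv: "transpose U *v (V *v v) = \<sigma> *\<^sub>R u" "transpose V *v (U *v u) = \<sigma> *\<^sub>R v"
      using st by (simp_all add: singular_triple_def matrix_vector_mul_assoc matrix_transpose_mul)
    have "P *v (V *v v) = \<sigma> *\<^sub>R (U *v u)" "Q *v (U *v u) = \<sigma> *\<^sub>R (V *v v)"
      by (simp_all add: P Q uv matrix_vector_mult_scaleR
          flip: matrix_vector_mul_assoc)
    moreover have "Q *v (V *v v) = V *v v"
      using UV(2) projection_mult[of V V] by (simp add: Q matrix_vector_mul_assoc)
    ultimately have "(Q ** P ** Q) *v (V *v v) = \<sigma>\<^sup>2 *\<^sub>R (V *v v)"
      by (simp add: power2_eq_square matrix_vector_mult_scaleR flip: matrix_vector_mul_assoc)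
    moreover have "V *v v \<noteq> 0"
      using st norm_orthonormal_columns[OF UV(2), of v] by (auto simp: singular_triple_def)
    ultimately have "\<sigma>\<^sup>2 \<in> ?E"
      by blast
    moreover have "sqrt (\<sigma>\<^sup>2) = \<sigma>"
      using st by (simp add: singular_triple_def)
    ultimately show "t \<in> (\<lambda>c. arccos (sqrt c)) ` ?E"
      using t by (intro image_eqI[where x = "\<sigma>\<^sup>2"]) simp_all
  qed
  moreover have "finite ?E"
    by (rule finite_eigenvalues_symmetric) (simp add: matrix_transpose_mul symm matrix_mul_assoc)
  ultimately show ?thesis
    using finite_surj by blast
qed simp

section \<open>From the least singular value to the sine of the largest angle\<close>

text \<open>By compactness |M x| attains its minimum sigma on the unit sphere, and a minimiser v
  turns out to be a right singular vector for sigma.\<close>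

lemma least_singular_value:
  fixes M :: "real^'n^'n"
  obtains \<sigma> where "\<sigma> \<in> singular_values M" and "\<And>x. \<sigma> * norm x \<le> norm (M *v x)"
proof -
  have "continuous_on (sphere 0 1) (\<lambda>x. norm (M *v x))"
    by (intro continuous_intros linear_continuous_on) simp
  moreover have "sphere (0::real^'n) 1 \<noteq> {}"
    by simp
  ultimately obtain v where v: "norm v = 1"
    and v_min: "\<And>y. norm y = 1 \<Longrightarrow> norm (M *v v) \<le> norm (M *v y)"
    using continuous_attains_inf[OF compact_sphere, of 0 1 "\<lambda>x. norm (M *v x)"] by auto
  define \<sigma> where "\<sigma> = norm (M *v v)"
  have lower: "\<sigma> * norm x \<le> norm (M *v x)" for x
  proof (cases "x = 0")
    case False
    then show ?thesis
      using v_min[of "(1 / norm x) *\<^sub>R x"]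
      by (simp add: \<sigma>_def matrix_vector_mult_scaleR field_simps)
  qed simp
  define g where "g = transpose M *v (M *v v) - \<sigma>\<^sup>2 *\<^sub>R v"
  \<comment> \<open>The quadratic form \<open>|M x|\<^sup>2 - \<sigma>\<^sup>2 |x|\<^sup>2\<close> is nonnegative and vanishes at \<open>v\<close>, hence
    so does its gradient \<open>2 g\<close> there.\<close>
  have "g = 0"
  proof (rule ccontr)
    assume "g \<noteq> 0"
    define a where "a = (norm (M *v g))\<^sup>2 - \<sigma>\<^sup>2 * (norm g)\<^sup>2"
    have a: "a \<ge> 0"
      using power_mono[OF lower[of g], of 2] by (simp add: a_def power_mult_distrib \<sigma>_def)
    have gg: "(M *v v) \<bullet> (M *v g) - \<sigma>\<^sup>2 * (v \<bullet> g) = g \<bullet> g"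
    proof -
      have "(M *v v) \<bullet> (M *v g) = (transpose M *v (M *v v)) \<bullet> g"
        by (simp add: inner_matrix_vector_mult_left)
      also have "\<dots> = g \<bullet> g + \<sigma>\<^sup>2 * (v \<bullet> g)"
        by (simp add: inner_diff_left[of _ _ g, folded g_def] flip: inner_scaleR_left inner_add_left)
          (simp add: g_def)
      finally show ?thesis
        by simp
    qed
    have q: "0 \<le> 2 * t * (g \<bullet> g) + t\<^sup>2 * a" for t
    proof -
      have "(\<sigma> * norm (v + t *\<^sub>R g))\<^sup>2 \<le> (norm (M *v (v + t *\<^sub>R g)))\<^sup>2"
        by (rule power_mono[OF lower]) (simp add: \<sigma>_def)
      moreover have "(norm (v + t *\<^sub>R g))\<^sup>2 = 1 + 2 * t * (v \<bullet> g) + t\<^sup>2 * (norm g)\<^sup>2"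
        using v by (simp add: power2_norm_eq_inner inner_add_left inner_add_right inner_commute
            power2_eq_square[of t] norm_eq_1)
      moreover have "(norm (M *v (v + t *\<^sub>R g)))\<^sup>2 =
          \<sigma>\<^sup>2 + 2 * t * ((M *v v) \<bullet> (M *v g)) + t\<^sup>2 * (norm (M *v g))\<^sup>2"
        by (simp add: \<sigma>_def power2_norm_eq_inner inner_add_left inner_add_right inner_commute
            power2_eq_square[of t] matrix_vector_right_distrib matrix_vector_mult_scaleR)
      ultimately have "0 \<le> 2 * t * ((M *v v) \<bullet> (M *v g) - \<sigma>\<^sup>2 * (v \<bullet> g)) + t\<^sup>2 * a"
        by (simp add: a_def algebra_simps power_mult_distrib)
      then show ?thesis
        by (simp add: gg)
    qed
    have "0 < g \<bullet> g"
      using \<open>g \<noteq> 0\<close> by simp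
    \<comment> \<open>For small negative t the linear term wins: here 2 |g|^2 + t a = |g|^2 - t > 0,
      so its product with t is negative, against \<open>q\<close>. The added 1 covers a = 0.\<close>
    define t where "t = - (g \<bullet> g) / (a + 1)"
    have "t * (a + 1) = - (g \<bullet> g)"
      using a by (simp add: t_def)
    moreover have "0 \<le> t * (2 * (g \<bullet> g) + t * a)"
      using q[of t] by (simp add: algebra_simps power2_eq_square)
    moreover have "t < 0"
      using a \<open>0 < g \<bullet> g\<close> by (simp add: t_def divide_neg_pos)
    ultimately show False
      using \<open>0 < g \<bullet> g\<close> by (smt (verit) distrib_left mult.right_neutral mult_neg_pos)
  qed
  then have MTM: "transpose M *v (M *v v) = \<sigma>\<^sup>2 *\<^sub>R v"
    by (simp add: g_def)
  have "\<exists>u. singular_triple M \<sigma> u v"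
  proof (cases "\<sigma> = 0")
    case True
    then have "M *v v = 0" "v \<noteq> 0"
      using v by (auto simp: \<sigma>_def)
    then have "rank (transpose M) \<noteq> CARD('n)"
      using matrix_nonfull_linear_equations_eq[of M] by (auto simp: rank_transpose)
    then obtain w where w: "w \<noteq> 0" "transpose M *v w = 0"
      using matrix_nonfull_linear_equations_eq[of "transpose M"] by auto
    then have "singular_triple M \<sigma> ((1 / norm w) *\<^sub>R w) v"
      using True v \<open>M *v v = 0\<close>
      by (simp add: singular_triple_def matrix_vector_mult_scaleR)
    then show ?thesis
      by blast
  next
    case False
    then have "\<sigma> > 0"
      by (simp add: \<sigma>_def)
    then have "singular_triple M \<sigma> ((1 / \<sigma>) *\<^sub>R (M *v v)) v"
      using v MTM
      by (simp add: singular_triple_def matrix_vector_mult_scaleR power2_eq_square flip: \<sigma>_def)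
    then show ?thesis
      by blast
  qed
  then show ?thesis
    using that lower by (auto simp: singular_values_def)
qed

text \<open>By Pythagoras the squared residual is |x|^2 - |U^T V x|^2, at most (1 - sigma^2) |x|^2
  for the least singular value sigma. Since arccos sigma is one of the angles, it is at most
  \<open>\<theta>\<close>, and sine is increasing up to pi/2.\<close>

lemma sin_max_canonical_angle:
  fixes U V :: "real^'r^'n"
  assumes U: "orthonormal_columns U" and V: "orthonormal_columns V"
    and \<theta>: "\<theta> = max_canonical_angle TYPE('r) (column_space U) (column_space V)"
  shows "0 \<le> sin \<theta>"
    and "norm (V *v x - U *v (transpose U *v (V *v x))) \<le> sin \<theta> * norm x"
proof -
  let ?C = "canonical_angles TYPE('r) (column_space U) (column_space V)"
  obtain \<sigma> where \<sigma>: "\<sigma> \<in> singular_values (transpose U ** V)"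
    and lower: "\<And>x. \<sigma> * norm x \<le> norm ((transpose U ** V) *v x)"
    using least_singular_value[of "transpose U ** V"] by metis
  have pythagoras: "(norm (V *v x - U *v (transpose U *v (V *v x))))\<^sup>2 =
      (norm x)\<^sup>2 - (norm ((transpose U ** V) *v x))\<^sup>2" for x
  proof -
    let ?y = "V *v x" and ?z = "transpose U *v (V *v x)"
    have "(norm (?y - U *v ?z))\<^sup>2 = ?y \<bullet> ?y - 2 * ((U *v ?z) \<bullet> ?y) + (U *v ?z) \<bullet> (U *v ?z)"
      by (simp add: power2_norm_eq_inner inner_diff_left inner_diff_right inner_commute)
    also have "\<dots> = x \<bullet> x - ?z \<bullet> ?z"
      using inner_orthonormal_columns[OF U, of ?z ?z] inner_orthonormal_columns[OF V, of x x]
        inner_matrix_vector_mult_left[of U ?z ?y] by simp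
    finally show ?thesis
      by (simp add: power2_norm_eq_inner matrix_vector_mul_assoc)
  qed
  \<comment> \<open>Stated for arbitrary bases, since the maximal angle may be presented by bases
    other than U and V. A singular value is an inner product of two unit vectors.\<close>
  have range: "0 \<le> s \<and> s \<le> 1" if prems: "orthonormal_columns U'" "orthonormal_columns V'"
    "s \<in> singular_values (transpose U' ** V')" for s and U' V' :: "real^'r^'n"
  proof -
    obtain u v where st: "singular_triple (transpose U' ** V') s u v"
      using prems by (auto simp: singular_values_def)
    then have "s = u \<bullet> ((transpose U' ** V') *v v)"
      by (simp add: singular_triple_def norm_eq_1)
    also have "\<dots> = (U' *v u) \<bullet> (V' *v v)"
      by (simp add: inner_matrix_vector_mult_left matrix_vector_mul_assoc)
    also have "\<dots> \<le> norm (U' *v u) * norm (V' *v v)"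
      by (rule norm_cauchy_schwarz)
    also have "\<dots> = 1"
      using st prems by (simp add: norm_orthonormal_columns singular_triple_def)
    finally show ?thesis
      using st by (simp add: singular_triple_def)
  qed
  have s1: "0 \<le> \<sigma>" "\<sigma> \<le> 1"
    using range[OF U V \<sigma>] by auto
  have mem: "arccos \<sigma> \<in> ?C"
    unfolding canonical_angles_def using U V \<sigma> by blast
  then have le: "arccos \<sigma> \<le> \<theta>"
    unfolding \<theta> max_canonical_angle_def by (intro Max_ge finite_canonical_angles)
  have "\<theta> \<in> ?C"
    unfolding \<theta> max_canonical_angle_def using mem by (intro Max_in finite_canonical_angles) auto
  then obtain s where "\<theta> = arccos s" "0 \<le> s" "s \<le> 1"
    using range unfolding canonical_angles_def by blast
  then have "0 \<le> \<theta>" "\<theta> \<le> pi / 2"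
    using arccos_lbound[of s] arccos_le_pi2[of s] by auto
  then show sin0: "0 \<le> sin \<theta>"
    by (intro sin_ge_zero) auto
  have "sin (arccos \<sigma>) \<le> sin \<theta>"
    using le s1 \<open>\<theta> \<le> pi / 2\<close> by (intro sin_monotone_2pi_le) (auto intro: order_trans[OF _ arccos_lbound])
  then have "1 - \<sigma>\<^sup>2 \<le> (sin \<theta>)\<^sup>2"
    using s1 sin0 by (simp add: sin_arccos real_sqrt_le_iff real_le_lsqrt sqrt_le_D)
  then have "(1 - \<sigma>\<^sup>2) * (norm x)\<^sup>2 \<le> (sin \<theta> * norm x)\<^sup>2"
    by (simp add: power_mult_distrib mult_right_mono)
  moreover have "(\<sigma> * norm x)\<^sup>2 \<le> (norm ((transpose U ** V) *v x))\<^sup>2"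
    using s1 by (intro power_mono lower) auto
  ultimately have "(norm (V *v x - U *v (transpose U *v (V *v x))))\<^sup>2 \<le> (sin \<theta> * norm x)\<^sup>2"
    unfolding pythagoras by (simp add: power_mult_distrib algebra_simps)
  then show "norm (V *v x - U *v (transpose U *v (V *v x))) \<le> sin \<theta> * norm x"
    by (rule power2_le_imp_le) (simp add: sin0)
qed

text \<open>Dual form of the previous bound: P_V (I - P_U) is the adjoint of (I - P_U) P_V. Testing
  h against V w with w = V^T h moves I - P_U onto V w.\<close>

lemma sin_max_canonical_angle_adjoint:
  fixes U V :: "real^'r^'n"
  assumes U: "orthonormal_columns U" and V: "orthonormal_columns V"
    and \<theta>: "\<theta> = max_canonical_angle TYPE('r) (column_space U) (column_space V)"
    and h: "transpose U *v h = 0"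
  shows "norm (V *v (transpose V *v h)) \<le> sin \<theta> * norm h"
proof -
  let ?w = "transpose V *v h"
  have "(norm ?w)\<^sup>2 = h \<bullet> (V *v ?w)"
    by (simp add: power2_norm_eq_inner inner_commute flip: inner_matrix_vector_mult_left)
  also have "\<dots> = h \<bullet> (V *v ?w - U *v (transpose U *v (V *v ?w)))"
  proof -
    have "h \<bullet> (U *v z) = 0" for z
      using h by (simp add: inner_commute[of h] inner_matrix_vector_mult_left)
    then show ?thesis
      by (simp add: inner_diff_right)
  qed
  also have "\<dots> \<le> norm h * (sin \<theta> * norm ?w)"
    by (rule order_trans[OF norm_cauchy_schwarz])
      (intro mult_left_mono sin_max_canonical_angle(2)[OF U V \<theta>] norm_ge_zero)
  finally have "norm ?w * norm ?w \<le> (sin \<theta> * norm h) * norm ?w"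
    by (simp add: power2_eq_square mult.commute mult.left_commute)
  then have "norm ?w \<le> sin \<theta> * norm h"
    using sin_max_canonical_angle(1)[OF U V \<theta>] by (cases "?w = 0") auto
  then show ?thesis
    by (simp add: norm_orthonormal_columns[OF V])
qed

section \<open>Oblique projections\<close>

lemma norm_le_spectral_norm: "norm (M *v x) \<le> spectral_norm M * norm x"
  unfolding spectral_norm_def by (rule onorm) simp

lemma spectral_norm_nonneg: "0 \<le> spectral_norm M"
  unfolding spectral_norm_def by (rule onorm_pos_le) simp

text \<open>If \<open>x = a + b\<close> with \<open>a = D x\<close> and \<open>b = x - D x\<close> both nonzero, then rescaling \<open>a\<close> to the
  length of \<open>b\<close> and \<open>b\<close> to the length of \<open>a\<close> does not change the length of the sum, whereas
  \<open>D\<close> now maps this sum to a vector of length \<open>|b|\<close>.\<close>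

lemma norm_complement_le_spectral_norm:
  fixes D :: "real^'n^'n"
  assumes idem: "D ** D = D" and "D \<noteq> 0"
  shows "norm (x - D *v x) \<le> spectral_norm D * norm x"
proof -
  define a where "a = D *v x"
  define b where "b = x - D *v x"
  have Da: "D *v a = a"
    by (simp add: a_def matrix_vector_mul_assoc idem)
  then have Db: "D *v b = 0"
    by (simp add: b_def matrix_vector_mult_diff_distrib flip: a_def)
  have x: "x = a + b"
    by (simp add: a_def b_def)
  consider "a = 0" | "b = 0" | "a \<noteq> 0" "b \<noteq> 0"
    by blast
  then have "norm b \<le> spectral_norm D * norm x"
  proof cases
    case 1
    \<comment> \<open>A nonzero projection fixes some nonzero vector D y, so its norm is at least 1,
      which suffices when x = b.\<close>
    obtain y where y: "D *v y \<noteq> 0"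
      using \<open>D \<noteq> 0\<close> by (auto simp: matrix_eq)
    have "norm (D *v y) \<le> spectral_norm D * norm (D *v y)"
      using norm_le_spectral_norm[of D "D *v y"] by (simp add: matrix_vector_mul_assoc idem)
    then have "1 \<le> spectral_norm D"
      using y by simp
    then show ?thesis
      using 1 x mult_right_mono[of 1 "spectral_norm D" "norm x"] by simp
  next
    case 2
    then show ?thesis
      by (simp add: spectral_norm_nonneg)
  next
    case 3
    define w where "w = (norm b / norm a) *\<^sub>R a + (norm a / norm b) *\<^sub>R b"
    have "w \<bullet> w = x \<bullet> x"
    proof -
      have "w \<bullet> w = (norm b / norm a)\<^sup>2 * (a \<bullet> a) + 2 * (norm b / norm a) * (norm a / norm b) * (a \<bullet> b)
          + (norm a / norm b)\<^sup>2 * (b \<bullet> b)"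
        by (simp add: w_def inner_add_left inner_add_right inner_commute power2_eq_square)
      also have "\<dots> = b \<bullet> b + 2 * (a \<bullet> b) + a \<bullet> a"
        using 3 by (simp add: power_divide flip: power2_norm_eq_inner)
      also have "\<dots> = x \<bullet> x"
        by (simp add: x inner_add_left inner_add_right inner_commute)
      finally show ?thesis .
    qed
    then have "norm w = norm x"
      by (simp add: norm_eq_sqrt_inner)
    moreover have "D *v w = (norm b / norm a) *\<^sub>R a"
      by (simp add: w_def matrix_vector_right_distrib matrix_vector_mult_scaleR Da Db)
    then have "norm (D *v w) = norm b"
      using 3 by simp
    ultimately show ?thesis
      using norm_le_spectral_norm[of D w] by simp
  qed
  then show ?thesis
    by (simp add: b_def)
qed

section \<open>Projections built from a basis and a selection operator\<close>

text \<open>All identities come from cancelling N = S^T W against its two-sided inverse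
  \<open>pinv\<close>. The rank of S is bounded below by that of N.\<close>

lemma deim_projection:
  fixes W :: "real^'r^'n" and S :: "real^'s^'n"
  assumes "CARD('s) = CARD('r)" and "rank (transpose S ** W) = CARD('r)"
    and D: "D = W ** pinv (transpose S ** W) ** transpose S"
  shows "D ** W = W" and "transpose S ** D = transpose S" and "D ** D = D"
    and "rank S = CARD('s)"
proof -
  let ?N = "transpose S ** W"
  note N = pinv_full_rank[OF assms(2,1)]
  have "D ** W = W ** (pinv ?N ** ?N)"
    by (simp only: D matrix_mul_assoc)
  then show DW: "D ** W = W"
    by (simp add: N)
  have "transpose S ** D = ?N ** pinv ?N ** transpose S"
    by (simp only: D matrix_mul_assoc)
  then show "transpose S ** D = transpose S"
    by (simp add: N)
  have "D ** D = D ** W ** pinv ?N ** transpose S"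
    by (subst (2) D) (simp only: matrix_mul_assoc)
  then show "D ** D = D"
    unfolding DW by (simp only: D)
  show "rank S = CARD('s)"
    using rank_mul_le_left[of "transpose S" W] rank_bound[of S] assms by (simp add: rank_transpose)
qed

text \<open>The columns of S need not be normalised, while the angle estimates need orthonormal
  bases; the relations between S and D are therefore transferred to such a basis U of the column
  space of S.\<close>

lemma deim_basis:
  fixes S :: "real^'s^'n" and W :: "real^'r^'n"
  assumes "CARD('s) = CARD('r)" and "rank (transpose S ** W) = CARD('r)"
    and D: "D = W ** pinv (transpose S ** W) ** transpose S"
  obtains U :: "real^'s^'n" where "orthonormal_columns U" "column_space U = column_space S"
    "S ** pinv S = U ** transpose U" "transpose U ** D = transpose U" "D ** (U ** transpose U) = D"
proof -
  have rank: "rank S = CARD('s)"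
    using deim_projection(4)[OF assms] .
  then have "dim (column_space S) = CARD('s)"
    by (simp add: column_space_def column_rank_def)
  then obtain U :: "real^'s^'n" where U: "orthonormal_columns U" "column_space U = column_space S"
    using orthonormal_columns_exist[of "column_space S"] by (auto simp: column_space_def)
  have P: "S ** pinv S = U ** transpose U"
    using mult_pinv_eq_projection[OF rank U] .
  have S: "transpose S ** (U ** transpose U) = transpose S"
    using projection_mult[OF U(1), of S] U(2)
    by (metis matrix_mul_assoc matrix_transpose_mul order_refl transpose_transpose)
  have "U ** transpose U = transpose (U ** transpose U)"
    by (simp add: matrix_transpose_mul)
  \<comment> \<open>Transposing the symmetric S \<open>pinv S\<close> puts S^T on the right, so U^T
    factors through S^T and inherits S^T D = S^T.\<close>
  then have P': "U ** transpose U = transpose (pinv S) ** transpose S"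
    unfolding P[symmetric] by (simp add: matrix_transpose_mul)
  have "transpose U = transpose U ** (U ** transpose U)"
    using U(1) by (simp add: orthonormal_columns_def matrix_mul_assoc)
  then have U': "transpose U = transpose U ** transpose (pinv S) ** transpose S"
    by (simp add: P' matrix_mul_assoc)
  have "transpose U ** D = transpose U"
  proof -
    have "transpose U ** D = transpose U ** transpose (pinv S) ** (transpose S ** D)"
      by (subst U') (simp only: matrix_mul_assoc)
    then show ?thesis
      using deim_projection(2)[OF assms] U' by simp
  qed
  moreover have "D ** (U ** transpose U) = D"
    unfolding D using S by (metis matrix_mul_assoc)
  ultimately show ?thesis
    using that U P by blast
qed

section \<open>The error bound\<close>

theorem theorem4p2:
  fixes A :: "real^'m^'n"
    and W W' :: "real^'r^'n"
    and S S' :: "real^'s^'n"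
    and D D' P\<^sub>W P\<^sub>S :: "real^'n^'n"
    and \<theta>max \<psi>max :: real
    and f :: "real^'n"
  assumes "CARD('m) \<le> CARD('n)"
    and "1 \<le> CARD('r)" and "CARD('r) \<le> rank A"
    and "orthonormal_columns W" and "leading_left_singular_vectors A W"
    and "orthonormal_columns W'"
    and "CARD('s) = CARD('r)"
    and "selection_operator S" and "selection_operator S'"
    and "D = W ** pinv (transpose S ** W) ** transpose S"
    and "D' = W' ** pinv (transpose S' ** W') ** transpose S'"
    and "rank D = CARD('r)" and "rank (transpose S ** W) = CARD('r)"
    and "rank D' = CARD('r)" and "rank (transpose S' ** W') = CARD('r)"
    and "D \<noteq> 0" and "D \<noteq> mat 1" and "D' \<noteq> 0" and "D' \<noteq> mat 1"
    and "P\<^sub>W = W ** transpose W" and "P\<^sub>S = S ** pinv S"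
    and "\<theta>max = max_canonical_angle TYPE('r) (column_space W) (column_space W')"
    and "\<psi>max = max_canonical_angle TYPE('s) (column_space S) (column_space S')"
  shows "norm (f - D' *v f) \<le>
           spectral_norm D * norm ((mat 1 - P\<^sub>W) *v f) +
           spectral_norm D * spectral_norm D' *
             (sin \<psi>max * norm ((mat 1 - P\<^sub>W) *v f) + sin \<theta>max * norm (P\<^sub>S *v f))"
proof -
  note D = deim_projection[OF assms(7,13,10)] and D' = deim_projection[OF assms(7,15,11)]
  obtain U :: "real^'s^'n" where U: "orthonormal_columns U" "column_space U = column_space S"
    "S ** pinv S = U ** transpose U" "transpose U ** D = transpose U" "D ** (U ** transpose U) = D"
    using deim_basis[OF assms(7,13,10)] by blast
  obtain U' :: "real^'s^'n" where U': "orthonormal_columns U'" "column_space U' = column_space S'"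
    "D' ** (U' ** transpose U') = D'"
    using deim_basis[OF assms(7,15,11)] by blast
  have \<psi>: "\<psi>max = max_canonical_angle TYPE('s) (column_space U) (column_space U')"
    using assms(23) U U' by simp
  \<comment> \<open>The order is reversed because the distance of W y from the column space of W' is
    to be estimated.\<close>
  have \<theta>: "\<theta>max = max_canonical_angle TYPE('r) (column_space W') (column_space W)"
    using assms(22) by (simp add: max_canonical_angle_commute)
  let ?d = "spectral_norm D" and ?d' = "spectral_norm D'" and ?g = "(mat 1 - P\<^sub>W) *v f"
  define h where "h = f - D *v f"
  define y where "y = pinv (transpose S ** W) *v (transpose S *v f)"
  have Df: "D *v f = W *v y"
    by (simp add: assms(10) y_def matrix_vector_mul_assoc matrix_mul_assoc)
  have h: "norm h \<le> ?d * norm ?g"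
  proof -
    \<comment> \<open>As D fixes \<open>P\<^sub>W *v f\<close>, its error on f equals its error on
      the component orthogonal to the columns of W.\<close>
    have "D *v (P\<^sub>W *v f) = P\<^sub>W *v f"
      using D(1) by (simp add: assms(20) matrix_vector_mul_assoc matrix_mul_assoc)
    then have "h = ?g - D *v ?g"
      by (simp add: h_def matrix_vector_mult_diff_distrib matrix_vector_mult_diff_rdistrib)
    then show ?thesis
      using norm_complement_le_spectral_norm[OF D(3) assms(16), of ?g] by simp
  qed
  have D'h: "norm (D' *v h) \<le> ?d' * (sin \<psi>max * norm h)"
  proof -
    \<comment> \<open>The error h is orthogonal to the columns of S, and D' sees only the projection
      of h onto the columns of S', which is small by the dual sine bound.\<close>
    have "transpose U *v h = 0"
      using U(4) by (simp add: h_def matrix_vector_mult_diff_distrib matrix_vector_mul_assoc)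
    then have "norm (U' *v (transpose U' *v h)) \<le> sin \<psi>max * norm h"
      by (rule sin_max_canonical_angle_adjoint[OF U(1) U'(1) \<psi>])
    moreover have "D' *v h = D' *v (U' *v (transpose U' *v h))"
      using U'(3) by (simp add: matrix_vector_mul_assoc matrix_mul_assoc)
    ultimately show ?thesis
      using norm_le_spectral_norm[of D' "U' *v (transpose U' *v h)"] spectral_norm_nonneg[of D']
      by (metis mult_left_mono order_trans)
  qed
  have Wy: "norm (W *v y - D' *v (W *v y)) \<le> ?d' * (sin \<theta>max * (?d * norm (P\<^sub>S *v f)))"
  proof -
    let ?z = "W *v y - W' *v (transpose W' *v (W *v y))"
    \<comment> \<open>I - D' annihilates the columns of W', so W y may be replaced by its residual
      z.\<close>
    have "D' *v (W' *v x) = W' *v x" for x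
      using D'(1) by (simp add: matrix_vector_mul_assoc)
    then have "W *v y - D' *v (W *v y) = ?z - D' *v ?z"
      by (simp add: matrix_vector_mult_diff_distrib)
    also have "norm \<dots> \<le> ?d' * norm ?z"
      by (rule norm_complement_le_spectral_norm[OF D'(3) assms(18)])
    also have "\<dots> \<le> ?d' * (sin \<theta>max * norm y)"
      by (intro mult_left_mono sin_max_canonical_angle(2)[OF assms(6,4) \<theta>] spectral_norm_nonneg)
    also have "norm y \<le> ?d * norm (P\<^sub>S *v f)"
    proof -
      \<comment> \<open>D depends only on the component of f in the column space of S, and |y| = |W
        y| = |D f|.\<close>
      have "D *v f = D *v (P\<^sub>S *v f)"
        using U(3,5) by (simp add: assms(21) matrix_vector_mul_assoc matrix_mul_assoc)
      then show ?thesis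
        using norm_le_spectral_norm[of D "P\<^sub>S *v f"] Df norm_orthonormal_columns[OF assms(4), of y]
        by simp
    qed
    finally show ?thesis
      using sin_max_canonical_angle(1)[OF assms(6,4) \<theta>] spectral_norm_nonneg[of D']
      by (simp add: mult_left_mono)
  qed
  \<comment> \<open>I - D' is applied to the splitting f = h + W y, and the bound follows from the
    triangle inequality.\<close>
  have "f - D' *v f = h + (W *v y - D' *v (W *v y)) - D' *v h"
    by (simp add: h_def Df matrix_vector_mult_diff_distrib)
  then have "norm (f - D' *v f) \<le> norm h + norm (W *v y - D' *v (W *v y)) + norm (D' *v h)"
    by (metis norm_triangle_ineq norm_triangle_ineq4 add_right_mono order_trans)
  also have "\<dots> \<le> ?d * norm ?g + ?d' * (sin \<theta>max * (?d * norm (P\<^sub>S *v f))) +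
      ?d' * (sin \<psi>max * (?d * norm ?g))"
    using h D'h Wy sin_max_canonical_angle(1)[OF U(1) U'(1) \<psi>] spectral_norm_nonneg[of D']
    by (intro add_mono) (auto intro: order_trans mult_left_mono)
  finally show ?thesis
    by (simp add: algebra_simps)
qed

end
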